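(* For each $n\in\mathbb{N}$ consider the hypergeometric polynomial $F_n(z)={}_2F_1\left(-n,\frac{n+1}{2};\frac{n+3}{2};z\right)$ of degree $n$ in the complex variable $z$. As $n\to\infty$, the zeros of $F_n$ approach the section of the lemniscate $$L=\left\{z\in\mathbb{C}: \left|z(1-z)^2\right|=\frac{4}{27},\ \operatorname{Re}(z)>\frac{1}{3}\right\}.$$ That is, for every $\epsilon>0$ there exists $N$ such that for all $n\ge N$ every zero $\zeta\in\mathbb{C}$ of $F_n$ satisfies $\operatorname{dist}(\zeta,L)<\epsilon$.
   Context: For $n\in\mathbb{N}$ (positive integers), ${}_2F_1(-n,b;c;z)=\sum_{k=0}^{n}\frac{(-n)_k(b)_k}{(c)_k}\frac{z^k}{k!}$, where $(\alpha)_k=\alpha(\alpha+1)\cdots(\alpha+k-1)$ for $k\ge 1$ and $(\alpha)_0=1$ (Pochhammer's symbol). Here $\operatorname{dist}(\zeta,L)=\inf_{w\in L}|\zeta-w|$. *)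

theory Defs
  imports "HOL-Analysis.Analysis"
begin

definition hyp2F1_poly :: "nat \<Rightarrow> complex \<Rightarrow> complex \<Rightarrow> complex \<Rightarrow> complex" where
  "hyp2F1_poly n b c z =
     (\<Sum>k=0..n. pochhammer (- of_nat n) k * pochhammer b k / pochhammer c k * (z ^ k / fact k))"

definition F :: "nat \<Rightarrow> complex \<Rightarrow> complex" where
  "F n z = hyp2F1_poly n ((of_nat n + 1) / 2) ((of_nat n + 3) / 2) z"

definition L :: "complex set" where
  "L = {z. cmod (z * (1 - z)\<^sup>2) = 4 / 27 \<and> Re z > 1 / 3}"

(* infdist x {} = 0 by convention; this shows that infdist _ L is a genuine infimum. *)
lemma L_nonempty: "L \<noteq> {}"
proof -
  have "(4 / 3 :: complex) * (1 - 4 / 3)\<^sup>2 = 4 / 27"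
    by (simp add: power2_eq_square field_simps)
  then have "(4 / 3 :: complex) \<in> L"
    by (simp add: L_def power2_eq_square norm_mult)
  then show ?thesis by blast
qed

end

theory Submission
  imports Defs
begin

text \<open>
  Since \<open>b = (n + 1) / 2\<close> and \<open>c = b + 1\<close>, the ratio of Pochhammer symbols collapses to
  \<open>b / (b + k)\<close>, and \<open>F\<^sub>n\<close> becomes an integral of an \<open>n\<close>-th power:
  \<open>F\<^sub>n(z) = (n + 1) \<integral>\<^sub>0\<^sup>1 (t (1 - z t\<^sup>2))\<^sup>n dt\<close>. With \<open>z = w\<^sup>2\<close> and \<open>P(u) = u (1 - u\<^sup>2)\<close> this says that
  \<open>w\<^sup>n\<^sup>+\<^sup>1 F\<^sub>n(z) = (n + 1) \<integral>\<^sub>0\<^sup>w P(u)\<^sup>n du\<close> (lemmas \<open>F_has_integral\<close>, \<open>kernel_prim_scale\<close>).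
  The critical points of \<open>P\<close> are \<open>\<plusminus>1 / \<surd>3\<close>, the critical value is
  \<open>c = 2 / (3 \<surd>3)\<close>, and \<open>\<bar>P(w)\<bar>\<^sup>2 = \<bar>z (1 - z)\<^sup>2\<bar>\<close>, so that the lemniscate lies on the level \<open>\<bar>P\<bar> = c\<close>.

  The line \<open>Re z = 1/3\<close> separates two regimes.
  \<^item> If \<open>Re z \<le> 1/3\<close>, then \<open>\<bar>P\<bar>\<close> increases along the straight segment from \<open>0\<close> to \<open>w\<close>
    (\<open>norm_kernel_from_0\<close>). The endpoint \<open>w\<close> dominates the integral, and Laplace's method
    (\<open>endpoint_laplace\<close>) gives \<open>(n + 1) \<integral>\<^sub>0\<^sup>w P\<^sup>n \<sim> P(w)\<^sup>n\<^sup>+\<^sup>1 / P'(w)\<close>, so there is no zero except near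
    the critical point \<open>z = 1/3\<close>.
  \<^item> If \<open>Re z \<ge> 1/3\<close>, then \<open>\<bar>P\<bar>\<close> increases along the straight segment from \<open>1\<close> to \<open>w\<close>
    (\<open>norm_kernel_from_1\<close>). The integral splits as \<open>\<integral>\<^sub>0\<^sup>1 P\<^sup>n + \<integral>\<^sub>1\<^sup>w P\<^sup>n\<close>. The first part grows like
    \<open>c\<^sup>n\<close> and the second like \<open>\<bar>P(w)\<bar>\<^sup>n\<close>, both up to factors that do not matter exponentially, so they can
    cancel only near \<open>\<bar>P(w)\<bar> = c\<close>.

  All estimates are uniform on compact sets, and the zeros stay in the disc \<open>\<bar>1 - z\<bar> < 6\<close>
  (\<open>F_nonzero_far_from_1\<close>), so two compact sets cover every possible zero at distance
  at least \<open>\<epsilon>\<close> from the lemniscate.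
\<close>

section \<open>The hypergeometric polynomial as an integral of a power\<close>

text \<open>
  The cubic \<open>P\<close> of the introduction is \<open>kernel 1\<close>. The parameter \<open>z\<close> covers the rescaled form
  \<open>P(w t) = w * kernel (w\<^sup>2) t\<close>, which depends on \<open>w\<^sup>2\<close> only and stays meaningful at \<open>w = 0\<close>.
\<close>
definition kernel :: "complex \<Rightarrow> complex \<Rightarrow> complex" where
  "kernel z u = u * (1 - z * u\<^sup>2)"

text \<open>
  The primitive of \<open>kernel z u ^ n\<close> that vanishes at \<open>0\<close>, obtained by expanding the power; an explicit
  polynomial makes the path independence of the integrals automatic.
\<close>
definition kernel_prim :: "nat \<Rightarrow> complex \<Rightarrow> complex \<Rightarrow> complex" where
  "kernel_prim n z u =
     (\<Sum>k\<le>n. of_nat (n choose k) * (- z) ^ k * u ^ (n + 1 + 2 * k) / of_nat (n + 1 + 2 * k))"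

lemma kernel_0 [simp]: "kernel z 0 = 0" and kernel_1 [simp]: "kernel z 1 = 1 - z"
  by (simp_all add: kernel_def)

lemma kernel_derivative: "(kernel z has_field_derivative 1 - 3 * z * u\<^sup>2) (at u within S)"
  unfolding kernel_def by (auto intro!: derivative_eq_intros simp: power2_eq_square algebra_simps)

lemma continuous_on_kernel [continuous_intros]:
  "continuous_on S f \<Longrightarrow> continuous_on S g \<Longrightarrow> continuous_on S (\<lambda>x. kernel (f x) (g x))"
  unfolding kernel_def by (intro continuous_intros)

lemma kernel_prim_0 [simp]: "kernel_prim n z 0 = 0"
  by (simp add: kernel_prim_def)

lemma kernel_prim_derivative:
  "(kernel_prim n z has_field_derivative kernel z u ^ n) (at u within S)"
proof -
  have "(kernel_prim n z has_field_derivative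
          (\<Sum>k\<le>n. of_nat (n choose k) * (- z) ^ k * u ^ (n + 2 * k))) (at u within S)"
    unfolding kernel_prim_def [abs_def]
  proof (rule DERIV_sum)
    fix k
    have nz: "of_nat (n + 1 + 2 * k) \<noteq> (0::complex)"
      unfolding of_nat_eq_0_iff by simp
    have "((\<lambda>u. of_nat (n choose k) * (- z) ^ k * u ^ (n + 1 + 2 * k) / of_nat (n + 1 + 2 * k))
       has_field_derivative of_nat (n choose k) * (- z) ^ k *
         (of_nat (n + 1 + 2 * k) * (1 * u ^ (n + 1 + 2 * k - Suc 0))) / of_nat (n + 1 + 2 * k)) (at u within S)"
      by (intro DERIV_cdivide DERIV_cmult DERIV_power DERIV_ident)
    then show "((\<lambda>u. of_nat (n choose k) * (- z) ^ k * u ^ (n + 1 + 2 * k) / of_nat (n + 1 + 2 * k))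
       has_field_derivative of_nat (n choose k) * (- z) ^ k * u ^ (n + 2 * k)) (at u within S)"
      using nz by (simp add: mult.assoc del: of_nat_add of_nat_mult of_nat_Suc)
  qed
  also have "(\<Sum>k\<le>n. of_nat (n choose k) * (- z) ^ k * u ^ (n + 2 * k)) = kernel z u ^ n"
  proof -
    have "(1 - z * u\<^sup>2) ^ n = (\<Sum>k\<le>n. of_nat (n choose k) * (- z * u\<^sup>2) ^ k * 1 ^ (n - k))"
      using binomial_ring [of "- z * u\<^sup>2" 1 n] by simp
    also have "\<dots> = (\<Sum>k\<le>n. of_nat (n choose k) * (- z) ^ k * u ^ (2 * k))"
      by (simp only: power_mult_distrib power_mult power_one mult_1_right mult.assoc)
    finally show ?thesis
      unfolding kernel_def power_mult_distrib
      by (simp add: sum_distrib_left power_add mult_ac)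
  qed
  finally show ?thesis .
qed

text \<open>
  This is the substitution \<open>u = w t\<close>; it turns zeros of \<open>F n\<close> into zeros of \<open>kernel_prim n 1\<close>, a
  primitive whose integrand is free of parameters.
\<close>
lemma kernel_prim_scale: "w ^ (n + 1) * kernel_prim n (w\<^sup>2) 1 = kernel_prim n 1 w"
  unfolding kernel_prim_def sum_distrib_left
proof (intro sum.cong refl)
  fix k
  have "(- (w\<^sup>2)) ^ k = (- 1) ^ k * w ^ (2 * k)"
    by (simp add: power_minus [of "w\<^sup>2"] power_mult)
  then show "w ^ (n + 1) * (of_nat (n choose k) * (- (w\<^sup>2)) ^ k * 1 ^ (n + 1 + 2 * k) / of_nat (n + 1 + 2 * k))
      = of_nat (n choose k) * (- 1) ^ k * w ^ (n + 1 + 2 * k) / of_nat (n + 1 + 2 * k)"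
    by (simp add: power_add mult_ac del: of_nat_add of_nat_mult of_nat_Suc)
qed

lemma pochhammer_shift_quotient:
  fixes b :: "'a :: field_char_0"
  assumes "\<And>j. b + of_nat j \<noteq> 0"
  shows "pochhammer b k / pochhammer (b + 1) k = b / (b + of_nat k)"
proof -
  have "pochhammer b k * (b + of_nat k) = b * pochhammer (b + 1) k"
    using pochhammer_rec [of b k] pochhammer_rec' [of b k] by (simp add: mult_ac)
  moreover have "pochhammer (b + 1) k \<noteq> 0"
  proof
    assume "pochhammer (b + 1) k = 0"
    then obtain i where "b + 1 = - of_nat i" by (auto simp: pochhammer_eq_0_iff)
    then have "b + of_nat (Suc i) = 0" by (simp add: algebra_simps flip: add.assoc)
    then show False using assms by blast
  qed
  ultimately show ?thesis using assms [of k] by (simp add: field_simps)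
qed

text \<open>
  Termwise, \<open>(-n)\<^sub>k / k! = (-1)\<^sup>k (n choose k)\<close> and \<open>b / (b + k) = (n + 1) / (n + 1 + 2 k)\<close>; the last
  denominator is the one produced by integrating \<open>t\<^sup>n\<^sup>+\<^sup>2\<^sup>k\<close>.
\<close>
lemma F_eq_kernel_prim: "F n z = of_nat (n + 1) * kernel_prim n z 1"
proof -
  define b :: complex where "b = (of_nat n + 1) / 2"
  have b_shift: "b + of_nat j = of_nat (n + 1 + 2 * j) / 2" for j
    by (simp add: b_def add_divide_distrib)
  have b_nz: "b + of_nat j \<noteq> 0" for j
    unfolding b_shift using of_nat_neq_0 [of "n + 2 * j", where 'a = complex] by simp
  have b1: "(of_nat n + 3) / 2 = b + 1"
    by (simp add: b_def field_simps)
  have "F n z = (\<Sum>k=0..n. (pochhammer (- of_nat n) k / fact k)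
           * (pochhammer b k / pochhammer (b + 1) k) * z ^ k)"
    unfolding F_def hyp2F1_poly_def b1 b_def [symmetric] by (simp add: mult_ac)
  also have "\<dots> = (\<Sum>k=0..n. of_nat (n + 1) *
       (of_nat (n choose k) * (- z) ^ k * 1 ^ (n + 1 + 2 * k) / of_nat (n + 1 + 2 * k)))"
  proof (intro sum.cong refl)
    fix k
    have coeff: "pochhammer (- of_nat n) k / fact k = (- 1) ^ k * (of_nat (n choose k) :: complex)"
      by (simp add: binomial_gbinomial gbinomial_pochhammer mult.assoc [symmetric] power_mult_distrib [symmetric])
    have "b / (b + of_nat k) = (of_nat (n + 1) / 2) / (of_nat (n + 1 + 2 * k) / 2)"
      unfolding b_shift by (simp add: b_def add.commute)
    then have q: "b / (b + of_nat k) = of_nat (n + 1) / of_nat (n + 1 + 2 * k)"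
      by (simp del: of_nat_add of_nat_mult of_nat_Suc)
    show "(pochhammer (- of_nat n) k / fact k) * (pochhammer b k / pochhammer (b + 1) k) * z ^ k
        = of_nat (n + 1) *
       (of_nat (n choose k) * (- z) ^ k * 1 ^ (n + 1 + 2 * k) / of_nat (n + 1 + 2 * k))"
      unfolding coeff pochhammer_shift_quotient [OF b_nz] q power_minus [of z]
      by (simp add: mult_ac)
  qed
  finally show ?thesis
    by (simp add: kernel_prim_def sum_distrib_left atLeast0AtMost)
qed

lemma kernel_prim_segment:
  "((\<lambda>t. (b - a) * kernel z (a + of_real t * (b - a)) ^ n) has_integral
     kernel_prim n z b - kernel_prim n z a) {0..1}"
proof -
  have "((\<lambda>t. (b - a) * kernel z (a + of_real t * (b - a)) ^ n) has_integral
          kernel_prim n z (a + of_real 1 * (b - a)) - kernel_prim n z (a + of_real 0 * (b - a))) {0..1::real}"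
  proof (rule fundamental_theorem_of_calculus)
    fix t :: real
    have "((\<lambda>t. a + of_real t * (b - a)) has_vector_derivative (b - a)) (at t within {0..1})"
      by (auto intro!: derivative_eq_intros)
    from field_vector_diff_chain_within [OF this kernel_prim_derivative]
    show "((\<lambda>t. kernel_prim n z (a + of_real t * (b - a))) has_vector_derivative
            (b - a) * kernel z (a + of_real t * (b - a)) ^ n) (at t within {0..1})"
      by (simp add: o_def)
  qed simp
  then show ?thesis by simp
qed

lemma F_has_integral:
  "((\<lambda>t. kernel z (of_real t) ^ n) has_integral F n z / of_nat (n + 1)) {0..1}"
  using kernel_prim_segment [of 1 0 z n] of_nat_neq_0 [of n, where 'a = complex]
  by (simp add: F_eq_kernel_prim)

section \<open>Monotonicity of the modulus along rays\<close>

text \<open>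
  The derivative of \<open>\<bar>f\<bar>\<^sup>2\<close> along the segment has the sign of the real part in the second assumption. The
  factor \<open>s\<close> there is harmless and completes the radial vector \<open>u - a\<close>, which makes the expression
  factor nicely when \<open>f\<close> vanishes at \<open>a\<close>.
\<close>
lemma norm_increasing_along_segment:
  fixes f f' :: "complex \<Rightarrow> complex"
  assumes deriv: "\<And>u. (f has_field_derivative f' u) (at u)"
    and pos: "\<And>s. 0 < s \<Longrightarrow> s < 1 \<Longrightarrow>
      Re (of_real s * (b - a) * f' (a + of_real s * (b - a)) * cnj (f (a + of_real s * (b - a)))) > 0"
    and t: "0 \<le> t" "t < 1"
  shows "cmod (f (a + of_real t * (b - a))) < cmod (f b)"
proof -
  define p where "p s = a + of_real s * (b - a)" for s :: real
  define h where "h s = (cmod (f (p s)))\<^sup>2" for s :: real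
  have p_deriv: "(p has_vector_derivative (b - a)) (at s)" for s
    unfolding p_def by (auto intro!: derivative_eq_intros)
  have fp: "((\<lambda>s. f (p s)) has_vector_derivative ((b - a) * f' (p s))) (at s)" for s
    using field_vector_diff_chain_at [OF p_deriv deriv] by (simp add: o_def)
  have h_deriv: "(h has_real_derivative 2 * Re ((b - a) * f' (p s) * cnj (f (p s)))) (at s)" for s
  proof -
    have h_eq: "h = (\<lambda>s. (Re (f (p s)))\<^sup>2 + (Im (f (p s)))\<^sup>2)"
      by (simp add: h_def cmod_power2 fun_eq_iff)
    have re: "((\<lambda>s. Re (f (p s))) has_real_derivative Re ((b - a) * f' (p s))) (at s)"
      and im: "((\<lambda>s. Im (f (p s))) has_real_derivative Im ((b - a) * f' (p s))) (at s)"
      using fp [of s] by (auto simp: has_vector_derivative_complex_iff has_real_derivative_iff_has_vector_derivative)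
    show ?thesis unfolding h_eq
      by (rule derivative_eq_intros re im refl)+ (simp add: algebra_simps)
  qed
  have "h t < h 1"
  proof (rule DERIV_pos_imp_increasing_open [OF t(2)])
    fix s assume s: "t < s" "s < 1"
    then have "0 < Re (of_real s * (b - a) * f' (p s) * cnj (f (p s)))"
      using pos [of s] t by (simp add: p_def)
    also have "\<dots> = s * Re ((b - a) * f' (p s) * cnj (f (p s)))"
      by (simp add: mult.assoc)
    finally have "0 < 2 * Re ((b - a) * f' (p s) * cnj (f (p s)))"
      using s t by (simp add: zero_less_mult_iff)
    then show "\<exists>y. (h has_real_derivative y) (at s) \<and> 0 < y" using h_deriv by blast
  next
    show "continuous_on {t..1} h"
      using h_deriv by (meson DERIV_continuous continuous_at_imp_continuous_on)
  qed
  then have "cmod (f (p t)) < cmod (f (p 1))"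
    unfolding h_def by (rule power2_less_imp_less) simp
  then show ?thesis by (simp add: p_def)
qed

lemma scaled_re_less_one_third:
  fixes s :: real
  assumes "Re z \<le> 1 / 3" "0 \<le> s" "s < 1"
  shows "Re (z * (of_real s)\<^sup>2) < 1 / 3"
proof (cases "Re z \<le> 0")
  case True
  then have "s\<^sup>2 * Re z \<le> 0" by (simp add: mult_nonneg_nonpos)
  then show ?thesis by (simp add: mult.commute flip: of_real_power)
next
  case False
  have "s\<^sup>2 < 1" using assms by (simp add: power_less_one_iff)
  with False have "s\<^sup>2 * Re z < 1 * Re z" by (intro mult_strict_right_mono) auto
  with assms show ?thesis by (simp add: mult.commute flip: of_real_power)
qed

text \<open>
  With \<open>v = z t\<^sup>2 = x + i y\<close> the radial derivative has the sign of
  \<open>Re ((1 - 3 v) cnj (1 - v)) = (1 - x) (1 - 3 x) + 3 y\<^sup>2\<close>, which is positive as soon as \<open>x < 1/3\<close>.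
\<close>
lemma norm_kernel_from_0:
  assumes "Re z \<le> 1 / 3" "0 \<le> t" "t < 1"
  shows "cmod (kernel z (of_real t)) < cmod (1 - z)"
proof -
  have "cmod (kernel z (0 + of_real t * (1 - 0))) < cmod (kernel z 1)"
  proof (rule norm_increasing_along_segment [OF kernel_derivative _ assms(2,3)])
    fix s :: real assume s: "0 < s" "s < 1"
    define v where "v = z * (of_real s)\<^sup>2"
    have x: "Re v < 1 / 3"
      using scaled_re_less_one_third [OF assms(1)] s by (simp add: v_def)
    have "Re ((1 - 3 * v) * cnj (1 - v)) = (1 - Re v) * (1 - 3 * Re v) + 3 * (Im v)\<^sup>2"
      by (simp add: algebra_simps power2_eq_square)
    moreover have "0 < (1 - Re v) * (1 - 3 * Re v)" using x by simp
    ultimately have pos: "0 < Re ((1 - 3 * v) * cnj (1 - v))"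
      by (smt (verit) zero_le_power2)
    have "of_real s * (1 - 3 * v) * cnj (of_real s * (1 - v)) = of_real (s\<^sup>2) * ((1 - 3 * v) * cnj (1 - v))"
      by (simp add: power2_eq_square)
    then have "Re (of_real s * (1 - 3 * v) * cnj (of_real s * (1 - v))) = s\<^sup>2 * Re ((1 - 3 * v) * cnj (1 - v))"
      by (simp only: scaleR_conv_of_real [symmetric] scaleR_complex.sel)
    also have "\<dots> > 0" using pos s by simp
    finally show "0 < Re (of_real s * (1 - 0) * (1 - 3 * z * (0 + of_real s * (1 - 0))\<^sup>2) *
        cnj (kernel z (0 + of_real s * (1 - 0))))"
      by (simp only: kernel_def v_def diff_zero mult_1_right add_0 mult.assoc)
  qed
  then show ?thesis by simp
qed

text \<open>
  At \<open>u = x + i y\<close> the radial derivative has, after division by \<open>\<bar>u - 1\<bar>\<^sup>2\<close>, the sign of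
  \<open>Re ((3 u\<^sup>2 - 1) cnj (u (u + 1)))\<close>. This is a polynomial in \<open>x\<close> and \<open>y\<^sup>2\<close> whose value at \<open>y = 0\<close> is
  \<open>x (x + 1) (3 x\<^sup>2 - 1)\<close> and whose other coefficients are positive for \<open>x > 0\<close>; so it is positive
  to the right of the critical point \<open>1 / \<surd>3\<close>.
\<close>
lemma norm_kernel_from_1:
  assumes "w \<noteq> 1" "1 / sqrt 3 \<le> Re w" "0 \<le> t" "t < 1"
  shows "cmod (kernel 1 (1 + of_real t * (w - 1))) < cmod (kernel 1 w)"
proof (rule norm_increasing_along_segment [OF kernel_derivative _ assms(3,4)])
  fix s :: real assume s: "0 < s" "s < 1"
  define u where "u = 1 + of_real s * (w - 1)"
  define x y where "x = Re u" and "y = Im u"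
  have u: "u = Complex x y" by (simp add: x_def y_def)
  have "u \<noteq> 1" using s assms by (simp add: u_def)
  have x: "1 / sqrt 3 < x"
  proof -
    have "x - r = (1 - s) * (1 - r) + s * (Re w - r)" for r
      by (simp add: x_def u_def algebra_simps)
    then have "x - 1 / sqrt 3 = (1 - s) * (1 - 1 / sqrt 3) + s * (Re w - 1 / sqrt 3)" .
    moreover have "0 < (1 - s) * (1 - 1 / sqrt 3)" using s by simp
    moreover have "0 \<le> s * (Re w - 1 / sqrt 3)" using s assms by simp
    ultimately show ?thesis by linarith
  qed
  then have x0: "0 < x" by (smt (verit) divide_pos_pos real_sqrt_gt_zero)
  have "(1 / sqrt 3)\<^sup>2 < x\<^sup>2" using x by (intro power_strict_mono) auto
  then have x2: "1 < 3 * x\<^sup>2" by (simp add: power_divide)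
  have "Re ((3 * u\<^sup>2 - 1) * cnj (u * (u + 1)))
      = x * (x + 1) * (3 * x\<^sup>2 - 1) + y\<^sup>2 * (6 * x\<^sup>2 + 3 * y\<^sup>2 + 3 * x + 1)"
    unfolding u by (simp add: complex_eq_iff power2_eq_square algebra_simps)
  moreover have "0 < x * (x + 1) * (3 * x\<^sup>2 - 1)" using x0 x2 by simp
  moreover have "0 \<le> y\<^sup>2 * (6 * x\<^sup>2 + 3 * y\<^sup>2 + 3 * x + 1)" using x0 by simp
  ultimately have pos: "0 < Re ((3 * u\<^sup>2 - 1) * cnj (u * (u + 1)))" by linarith
  have "(u - 1) * (1 - 3 * u\<^sup>2) * cnj (kernel 1 u)
      = of_real ((cmod (u - 1))\<^sup>2) * ((3 * u\<^sup>2 - 1) * cnj (u * (u + 1)))"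
    unfolding kernel_def complex_norm_square by (simp add: power2_eq_square algebra_simps)
  then have "Re ((u - 1) * (1 - 3 * u\<^sup>2) * cnj (kernel 1 u))
      = (cmod (u - 1))\<^sup>2 * Re ((3 * u\<^sup>2 - 1) * cnj (u * (u + 1)))"
    by (simp only: scaleR_conv_of_real [symmetric] scaleR_complex.sel)
  also have "\<dots> > 0" using pos \<open>u \<noteq> 1\<close> by simp
  finally show "0 < Re (of_real s * (w - 1) * (1 - 3 * 1 * (1 + of_real s * (w - 1))\<^sup>2) *
        cnj (kernel 1 (1 + of_real s * (w - 1))))"
    by (simp add: u_def)
qed

section \<open>Laplace's method at an endpoint, with a parameter\<close>

text \<open>
  Integrating the derivative of \<open>\<rho>\<^sup>n\<^sup>+\<^sup>1 / \<rho>'\<close> over \<open>[0, 1]\<close> gives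
  \<open>(n + 1) \<integral> \<rho>\<^sup>n = 1 / \<rho>'(1) + \<integral> \<rho>\<^sup>n\<^sup>+\<^sup>1 \<rho>'' / \<rho>'\<^sup>2\<close>, where the lower endpoint contributes nothing because
  \<open>\<rho>(0) = 0\<close>. The last integrand is bounded uniformly in the parameter, and away from \<open>t = 1\<close> it is
  uniformly exponentially small by compactness.
\<close>
lemma endpoint_laplace:
  fixes \<rho> \<rho>' \<rho>'' :: "'a :: metric_space \<Rightarrow> real \<Rightarrow> complex"
  assumes K: "compact K"
    and d1: "\<And>x t. x \<in> K \<Longrightarrow> t \<in> {0..1} \<Longrightarrow> (\<rho> x has_vector_derivative \<rho>' x t) (at t within {0..1})"
    and d2: "\<And>x t. x \<in> K \<Longrightarrow> t \<in> {0..1} \<Longrightarrow> (\<rho>' x has_vector_derivative \<rho>'' x t) (at t within {0..1})"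
    and cont: "continuous_on (K \<times> {0..1}) (\<lambda>x. \<rho> (fst x) (snd x))"
              "continuous_on (K \<times> {0..1}) (\<lambda>x. \<rho>' (fst x) (snd x))"
              "continuous_on (K \<times> {0..1}) (\<lambda>x. \<rho>'' (fst x) (snd x))"
    and ends: "\<And>x. x \<in> K \<Longrightarrow> \<rho> x 0 = 0" "\<And>x. x \<in> K \<Longrightarrow> \<rho> x 1 = 1"
    and nz: "\<And>x t. x \<in> K \<Longrightarrow> t \<in> {0..1} \<Longrightarrow> \<rho>' x t \<noteq> 0"
    and dom: "\<And>x t. x \<in> K \<Longrightarrow> 0 \<le> t \<Longrightarrow> t < 1 \<Longrightarrow> cmod (\<rho> x t) < 1"
  shows "uniform_limit K (\<lambda>n x. of_nat (n + 1) * integral {0..1} (\<lambda>t. \<rho> x t ^ n))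
           (\<lambda>x. 1 / \<rho>' x 1) sequentially"
proof -
  define h where "h x t = \<rho>'' x t / (\<rho>' x t)\<^sup>2" for x t
  have "continuous_on (K \<times> {0..1}) (\<lambda>x. h (fst x) (snd x))"
    unfolding h_def by (intro continuous_intros cont) (use nz in auto)
  then have "compact ((\<lambda>x. h (fst x) (snd x)) ` (K \<times> {0..1}))"
    using K by (intro compact_continuous_image compact_Times) auto
  then obtain C where C: "C > 0" "\<And>x t. x \<in> K \<Longrightarrow> t \<in> {0..1} \<Longrightarrow> cmod (h x t) \<le> C"
    by (force dest!: compact_imp_bounded simp: bounded_pos)

  have remainder: "((\<lambda>t. h x t * \<rho> x t ^ (n + 1)) has_integral
      of_nat (n + 1) * integral {0..1} (\<lambda>t. \<rho> x t ^ n) - 1 / \<rho>' x 1) {0..1}" if x: "x \<in> K" for x n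
  proof -
    have "((\<lambda>t. of_nat (n + 1) * \<rho> x t ^ n - h x t * \<rho> x t ^ (n + 1)) has_integral
       \<rho> x 1 ^ (n + 1) / \<rho>' x 1 - \<rho> x 0 ^ (n + 1) / \<rho>' x 0) {0..1}"
    proof (rule fundamental_theorem_of_calculus)
      fix t :: real assume t: "t \<in> {0..1}"
      have pow: "((\<lambda>v. v ^ (n + 1)) has_field_derivative of_nat (n + 1) * \<rho> x t ^ n) (at (\<rho> x t) within A)" for A
        using DERIV_power [OF DERIV_ident, of "n + 1" "\<rho> x t" A] by simp
      have inv: "(inverse has_field_derivative - (1 / (\<rho>' x t)\<^sup>2)) (at (\<rho>' x t) within A)" for A
        using nz [OF x t] by (auto intro!: derivative_eq_intros simp: power2_eq_square field_simps)
      have "((\<lambda>t. \<rho> x t ^ (n + 1) * inverse (\<rho>' x t)) has_vector_derivative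
          \<rho> x t ^ (n + 1) * (\<rho>'' x t * - (1 / (\<rho>' x t)\<^sup>2)) + (\<rho>' x t * (of_nat (n + 1) * \<rho> x t ^ n)) * inverse (\<rho>' x t))
          (at t within {0..1})"
        using has_vector_derivative_mult
          [OF field_vector_diff_chain_within [OF d1 [OF x t] pow] field_vector_diff_chain_within [OF d2 [OF x t] inv]]
        by (simp add: o_def)
      moreover have "\<rho> x t ^ (n + 1) * (\<rho>'' x t * - (1 / (\<rho>' x t)\<^sup>2)) + (\<rho>' x t * (of_nat (n + 1) * \<rho> x t ^ n)) * inverse (\<rho>' x t)
          = of_nat (n + 1) * \<rho> x t ^ n - h x t * \<rho> x t ^ (n + 1)"
        using nz [OF x t] by (simp add: h_def field_simps)
      ultimately show "((\<lambda>t. \<rho> x t ^ (n + 1) / \<rho>' x t) has_vector_derivative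
          of_nat (n + 1) * \<rho> x t ^ n - h x t * \<rho> x t ^ (n + 1)) (at t within {0..1})"
        by (simp only: divide_inverse)
    qed simp
    then have total: "((\<lambda>t. of_nat (n + 1) * \<rho> x t ^ n - h x t * \<rho> x t ^ (n + 1)) has_integral 1 / \<rho>' x 1) {0..1}"
      using ends [OF x] by simp
    have "continuous_on {0..1} (\<rho> x)"
      using continuous_on_vector_derivative [of "{0..1}" "\<rho> x" "\<rho>' x"] d1 [OF x] by blast
    then have "(\<lambda>t. \<rho> x t ^ n) integrable_on {0..1}"
      by (intro integrable_continuous_real continuous_intros)
    then have "((\<lambda>t. of_nat (n + 1) * \<rho> x t ^ n) has_integral
                 of_nat (n + 1) * integral {0..1} (\<lambda>t. \<rho> x t ^ n)) {0..1}"
      by (intro has_integral_mult_right integrable_integral)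
    from has_integral_diff [OF this total] show ?thesis by simp
  qed

  show ?thesis
    unfolding uniform_limit_iff
  proof (intro allI impI)
    fix e :: real assume e: "e > 0"
    \<comment> \<open>The final stretch of length \<open>\<eta>\<close> contributes at most \<open>C \<eta> < e / 2\<close>; the rest decays like \<open>q ^ (n + 1)\<close>.\<close>
    define \<eta> where "\<eta> = min (1 / 2) (e / (4 * C))"
    have \<eta>: "0 < \<eta>" "\<eta> < 1" "C * \<eta> < e / 2"
    proof -
      have "C * \<eta> \<le> C * (e / (4 * C))" using C by (intro mult_left_mono) (auto simp: \<eta>_def)
      also have "\<dots> = e / 4" using C by simp
      finally show "C * \<eta> < e / 2" using e by linarith
    qed (use e C in \<open>auto simp: \<eta>_def\<close>)
    obtain q where q: "0 \<le> q" "q < 1" "\<And>x t. x \<in> K \<Longrightarrow> t \<in> {0..1 - \<eta>} \<Longrightarrow> cmod (\<rho> x t) \<le> q"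
    proof (cases "K = {}")
      case True
      then show ?thesis using that [of 0] by auto
    next
      case False
      have "continuous_on (K \<times> {0..1 - \<eta>}) (\<lambda>x. cmod (\<rho> (fst x) (snd x)))"
        using \<eta> by (intro continuous_intros continuous_on_subset [OF cont(1)]) auto
      moreover have "compact (K \<times> {0..1 - \<eta>})" "K \<times> {0..1 - \<eta>} \<noteq> {}"
        using K False \<eta> by (auto intro: compact_Times)
      ultimately obtain x where x: "x \<in> K \<times> {0..1 - \<eta>}"
        "\<forall>y \<in> K \<times> {0..1 - \<eta>}. cmod (\<rho> (fst y) (snd y)) \<le> cmod (\<rho> (fst x) (snd x))"
        using continuous_attains_sup [of "K \<times> {0..1 - \<eta>}" "\<lambda>x. cmod (\<rho> (fst x) (snd x))"]
        by blast
      have "cmod (\<rho> (fst x) (snd x)) < 1"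
        using x(1) dom [of "fst x" "snd x"] \<eta> by auto
      moreover have "cmod (\<rho> y t) \<le> cmod (\<rho> (fst x) (snd x))" if "y \<in> K" "t \<in> {0..1 - \<eta>}" for y t
        using x(2) that by fastforce
      ultimately show ?thesis by (intro that [of "cmod (\<rho> (fst x) (snd x))"]) auto
    qed
    have "(\<lambda>n. C * q ^ (n + 1)) \<longlonglongrightarrow> C * 0"
      using LIMSEQ_power_zero [of q] q
      by (intro tendsto_mult tendsto_const LIMSEQ_ignore_initial_segment) auto
    then have "\<forall>\<^sub>F n in sequentially. C * q ^ (n + 1) < e / 2"
      by (rule order_tendstoD(2)) (use e in simp)
    then show "\<forall>\<^sub>F n in sequentially. \<forall>x\<in>K.
        dist (of_nat (n + 1) * integral {0..1} (\<lambda>t. \<rho> x t ^ n)) (1 / \<rho>' x 1) < e"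
    proof (eventually_elim, intro ballI)
      fix n x assume n: "C * q ^ (n + 1) < e / 2" and x: "x \<in> K"
      define g where "g t = h x t * \<rho> x t ^ (n + 1)" for t
      define I where "I = of_nat (n + 1) * integral {0..1} (\<lambda>t. \<rho> x t ^ n) - 1 / \<rho>' x 1"
      have g_int: "(g has_integral I) {0..1}"
        using remainder [OF x] by (simp only: g_def [abs_def] I_def)
      have "g integrable_on {0..1 - \<eta>}" "g integrable_on {1 - \<eta>..1}"
        using has_integral_integrable [OF g_int] \<eta> by (auto elim: integrable_on_subinterval)
      then obtain I1 I2 where I1: "(g has_integral I1) {0..1 - \<eta>}" and I2: "(g has_integral I2) {1 - \<eta>..1}"
        by (auto simp: integrable_on_def)
      have I: "I = I1 + I2"
        using has_integral_combine [OF _ _ I1 I2] g_int \<eta> by (auto intro: has_integral_unique)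
      have g_bound: "cmod (g t) \<le> C * r ^ (n + 1)"
        if "t \<in> {0..1}" "cmod (\<rho> x t) \<le> r" for t r
        unfolding g_def norm_mult norm_power
        using C(1) C(2) [OF x that(1)] that(2) by (intro mult_mono power_mono) auto
      have "cmod I1 \<le> C * q ^ (n + 1) * measure lborel {0..1 - \<eta>}"
        using C q \<eta> x by (intro has_integral_bound_real [where S = "{}", OF _ finite.emptyI I1] g_bound) auto
      also have "\<dots> \<le> C * q ^ (n + 1) * 1"
        using C q \<eta> by (intro mult_left_mono) auto
      finally have b1: "cmod I1 < e / 2" using n by simp
      have "cmod (\<rho> x t) \<le> 1" if "t \<in> {1 - \<eta>..1}" for t
        using dom [OF x, of t] that \<eta> ends(2) [OF x] by (cases "t = 1") auto
      then have "cmod I2 \<le> C * 1 ^ (n + 1) * measure lborel {1 - \<eta>..1}"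
        using C \<eta> by (intro has_integral_bound_real [where S = "{}", OF _ finite.emptyI I2] g_bound) auto
      then have b2: "cmod I2 < e / 2" using \<eta> by simp
      show "dist (of_nat (n + 1) * integral {0..1} (\<lambda>t. \<rho> x t ^ n)) (1 / \<rho>' x 1) < e"
        using norm_triangle_ineq [of I1 I2] b1 b2 unfolding dist_norm I_def [symmetric] I by linarith
    qed
  qed
qed

lemma compact_norm_lower_bound:
  fixes g :: "'a :: topological_space \<Rightarrow> 'b :: real_normed_vector"
  assumes "compact K" "continuous_on K g" "\<And>x. x \<in> K \<Longrightarrow> g x \<noteq> 0"
  obtains m where "m > 0" "\<And>x. x \<in> K \<Longrightarrow> m \<le> norm (g x)"
proof (cases "K = {}")
  case True
  then show ?thesis using that [of 1] by simp
next
  case False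
  then obtain x where "x \<in> K" "\<forall>y\<in>K. norm (g x) \<le> norm (g y)"
    using continuous_attains_inf [of K "\<lambda>x. norm (g x)"] assms continuous_on_norm by blast
  then show ?thesis using that [of "norm (g x)"] assms by auto
qed

lemma uniform_limit_lower_bound:
  fixes f :: "nat \<Rightarrow> 'a :: topological_space \<Rightarrow> 'b :: real_normed_vector"
  assumes lim: "uniform_limit K f l sequentially" and K: "compact K"
    and l: "continuous_on K l" "\<And>x. x \<in> K \<Longrightarrow> l x \<noteq> 0"
  obtains m where "m > 0" "\<forall>\<^sub>F n in sequentially. \<forall>x\<in>K. m \<le> norm (f n x)"
proof -
  obtain m where m: "m > 0" "\<And>x. x \<in> K \<Longrightarrow> m \<le> norm (l x)"
    using compact_norm_lower_bound [OF K l] by blast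
  have "\<forall>\<^sub>F n in sequentially. \<forall>x\<in>K. dist (f n x) (l x) < m / 2"
    by (rule uniform_limitD [OF lim]) (use m(1) in simp)
  then have "\<forall>\<^sub>F n in sequentially. \<forall>x\<in>K. m / 2 \<le> norm (f n x)"
  proof (eventually_elim, intro ballI)
    fix n x assume H: "\<forall>x\<in>K. dist (f n x) (l x) < m / 2" and x: "x \<in> K"
    have "norm (f n x - l x) < m / 2" using H x by (simp only: dist_norm)
    moreover have "norm (l x) \<le> norm (f n x) + norm (f n x - l x)"
      using norm_triangle_sub [of "l x" "f n x"] by (simp only: norm_minus_commute)
    ultimately show "m / 2 \<le> norm (f n x)" using m(2) [OF x] by linarith
  qed
  with m(1) that [of "m / 2"] show ?thesis by simp
qed

section \<open>Parameters to the left of the critical line\<close>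

text \<open>
  The endpoint \<open>t = 1\<close> of the integral for \<open>F n z\<close> dominates. The only critical point of the integrand
  that could lie on the path is \<open>t = 1\<close> itself, for \<open>z = 1/3\<close>.
\<close>
lemma F_nonzero_left_of_one_third:
  assumes K: "compact K" and re: "\<And>z. z \<in> K \<Longrightarrow> Re z \<le> 1 / 3" and third: "1 / 3 \<notin> K"
  shows "\<forall>\<^sub>F n in sequentially. \<forall>z\<in>K. F n z \<noteq> 0"
proof -
  define \<rho> where "\<rho> z t = kernel z (of_real t) / (1 - z)" for z :: complex and t :: real
  define \<rho>' where "\<rho>' z t = (1 - 3 * z * (of_real t)\<^sup>2) / (1 - z)" for z :: complex and t :: real
  define \<rho>'' where "\<rho>'' z t = - 6 * z * of_real t / (1 - z)" for z :: complex and t :: real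
  have z1: "z \<noteq> 1" if "z \<in> K" for z using re [OF that] by auto
  have nz: "1 - 3 * z * (of_real t)\<^sup>2 \<noteq> 0" if z: "z \<in> K" and t: "t \<in> {0..1}" for z t
  proof
    assume *: "1 - 3 * z * (of_real t)\<^sup>2 = 0"
    then have "Re (z * (of_real t)\<^sup>2) = 1 / 3" by (simp add: complex_eq_iff mult.assoc)
    with scaled_re_less_one_third [OF re [OF z], of t] t have "t = 1" by force
    with * have "z = 1 / 3" by (simp add: field_simps)
    with z third show False by simp
  qed
  have "uniform_limit K (\<lambda>n z. of_nat (n + 1) * integral {0..1} (\<lambda>t. \<rho> z t ^ n))
           (\<lambda>z. 1 / \<rho>' z 1) sequentially"
  proof (rule endpoint_laplace [OF K, where \<rho>'' = \<rho>''])
    fix z t assume z: "z \<in> K" and t: "t \<in> {0..1::real}"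
    have id': "((\<lambda>t. of_real t) has_vector_derivative (1 :: complex)) (at t within {0..1})"
      by (auto intro!: derivative_eq_intros)
    from field_vector_diff_chain_within [OF id', of "\<lambda>u. kernel z u / (1 - z)" "\<rho>' z t"]
    show "(\<rho> z has_vector_derivative \<rho>' z t) (at t within {0..1})"
      by (simp add: o_def \<rho>_def [abs_def] \<rho>'_def DERIV_cdivide kernel_derivative)
    show "(\<rho>' z has_vector_derivative \<rho>'' z t) (at t within {0..1})"
    proof -
      have "((\<lambda>u. 1 - 3 * z * u\<^sup>2) has_field_derivative - 6 * z * of_real t)
          (at (of_real t) within of_real ` {0..1})"
        by (auto intro!: derivative_eq_intros)
      from field_vector_diff_chain_within [OF id' DERIV_cdivide [OF this, of "1 - z"]] show ?thesis
        by (simp add: o_def \<rho>'_def [abs_def] \<rho>''_def)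
    qed
    show "\<rho>' z t \<noteq> 0" using nz [OF z t] z1 [OF z] by (simp add: \<rho>'_def)
  next
    fix z t assume z: "z \<in> K" and t: "0 \<le> t" "t < (1::real)"
    show "cmod (\<rho> z t) < 1"
      using norm_kernel_from_0 [OF re [OF z] t] z1 [OF z] by (simp add: \<rho>_def norm_divide)
  next
    fix z assume z: "z \<in> K"
    show "\<rho> z 0 = 0" "\<rho> z 1 = 1" using z1 [OF z] by (simp_all add: \<rho>_def)
  qed (unfold \<rho>_def \<rho>'_def \<rho>''_def, (intro continuous_intros; use z1 in force)+)
  moreover have "continuous_on K (\<lambda>z. 1 / \<rho>' z 1)"
    unfolding \<rho>'_def using nz [of _ 1] z1 by (intro continuous_intros) auto
  moreover have "1 / \<rho>' z 1 \<noteq> 0" if "z \<in> K" for z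
    using nz [OF that, of 1] z1 [OF that] by (simp add: \<rho>'_def)
  ultimately obtain m where m: "m > 0"
    "\<forall>\<^sub>F n in sequentially. \<forall>z\<in>K. m \<le> cmod (of_nat (n + 1) * integral {0..1} (\<lambda>t. \<rho> z t ^ n))"
    by (rule uniform_limit_lower_bound [OF _ K])
  from m(2) show ?thesis
  proof (eventually_elim, intro ballI notI)
    fix n z
    assume H: "\<forall>z\<in>K. m \<le> cmod (of_nat (n + 1) * integral {0..1} (\<lambda>t. \<rho> z t ^ n))"
      and z: "z \<in> K" and F0: "F n z = 0"
    have "((\<lambda>t. kernel z (of_real t) ^ n / (1 - z) ^ n) has_integral
        F n z / of_nat (n + 1) / (1 - z) ^ n) {0..1}"
      by (intro has_integral_divide F_has_integral)
    then have "((\<lambda>t. \<rho> z t ^ n) has_integral 0) {0..1}"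
      by (simp add: F0 \<rho>_def power_divide)
    then have "integral {0..1} (\<lambda>t. \<rho> z t ^ n) = 0"
      by (rule integral_unique)
    with H z m(1) show False by fastforce
  qed
qed

section \<open>Parameters to the right of the critical line\<close>

text \<open>
  Here the endpoint method applies to the path from \<open>1\<close> to \<open>w\<close>: its contribution is at least of
  order \<open>\<bar>P(w)\<bar>\<^sup>n / n\<close>. The excluded points are the critical point, where the endpoint
  asymptotics degenerate, and the base point, where the path does.
\<close>
lemma kernel_prim_dominates_right_of_one_third:
  assumes K: "compact K" and re: "\<And>w. w \<in> K \<Longrightarrow> 1 / sqrt 3 \<le> Re w"
    and crit: "of_real (1 / sqrt 3) \<notin> K" and one: "1 \<notin> K"
  obtains m where "m > 0" "\<forall>\<^sub>F n in sequentially. \<forall>w\<in>K.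
    m * cmod (kernel 1 w) ^ n \<le> real (n + 1) * cmod (kernel_prim n 1 w - kernel_prim n 1 1)"
proof -
  define u where "u w t = 1 + of_real t * (w - 1)" for w :: complex and t :: real
  define \<rho> where "\<rho> w t = kernel 1 (u w t) / kernel 1 w" for w t
  define \<rho>' where "\<rho>' w t = (w - 1) * (1 - 3 * (u w t)\<^sup>2) / kernel 1 w" for w t
  define \<rho>'' where "\<rho>'' w t = (w - 1) * (w - 1) * (- 6 * u w t) / kernel 1 w" for w t
  have w1: "w \<noteq> 1" if "w \<in> K" for w using that one by auto
  have k_nz: "kernel 1 w \<noteq> 0" if w: "w \<in> K" for w
    using norm_kernel_from_1 [OF w1 [OF w] re [OF w], of 0] by auto
  have nz: "1 - 3 * (u w t)\<^sup>2 \<noteq> 0" if w: "w \<in> K" and t: "t \<in> {0..1}" for w t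
  proof
    assume "1 - 3 * (u w t)\<^sup>2 = 0"
    then have "(u w t)\<^sup>2 = 1 / 3" by (simp add: field_simps)
    then have "(u w t)\<^sup>2 = (of_real (1 / sqrt 3))\<^sup>2"
      by (simp add: power_divide flip: of_real_power)
    then have u_cases: "u w t = of_real (1 / sqrt 3) \<or> u w t = - of_real (1 / sqrt 3)"
      by (simp only: power2_eq_iff)
    have re_u: "Re (u w t) - r = (1 - t) * (1 - r) + t * (Re w - r)" for r
      by (simp add: u_def algebra_simps)
    have nonneg: "0 \<le> (1 - t) * (1 - 1 / sqrt 3)" "0 \<le> t * (Re w - 1 / sqrt 3)"
      using t re [OF w] by simp_all
    have u_re: "1 / sqrt 3 \<le> Re (u w t)" using re_u [of "1 / sqrt 3"] nonneg by linarith
    have "0 < 1 / sqrt 3" by simp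
    with u_re u_cases have u_eq: "u w t = of_real (1 / sqrt 3)" by fastforce
    then have "Re (u w t) = 1 / sqrt 3" by (simp only: Re_complex_of_real)
    then have "(1 - t) * (1 - 1 / sqrt 3) = 0"
      using re_u [of "1 / sqrt 3"] nonneg by linarith
    then have "t = 1" by simp
    with u_eq w crit show False by (simp add: u_def)
  qed
  have "uniform_limit K (\<lambda>n w. of_nat (n + 1) * integral {0..1} (\<lambda>t. \<rho> w t ^ n))
           (\<lambda>w. 1 / \<rho>' w 1) sequentially"
  proof (rule endpoint_laplace [OF K, where \<rho>'' = \<rho>''])
    fix w t assume w: "w \<in> K" and t: "t \<in> {0..1::real}"
    have u': "(u w has_vector_derivative (w - 1)) (at t within {0..1})"
      unfolding u_def by (auto intro!: derivative_eq_intros)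
    from field_vector_diff_chain_within [OF u', of "\<lambda>u. kernel 1 u / kernel 1 w"
        "(1 - 3 * 1 * (u w t)\<^sup>2) / kernel 1 w"]
    show "(\<rho> w has_vector_derivative \<rho>' w t) (at t within {0..1})"
      by (simp add: o_def \<rho>_def [abs_def] \<rho>'_def DERIV_cdivide kernel_derivative [of 1, simplified])
    have "((\<lambda>v. (w - 1) * (1 - 3 * v\<^sup>2) / kernel 1 w) has_field_derivative
        (w - 1) * (- 6 * u w t) / kernel 1 w) (at (u w t) within u w ` {0..1})"
      using k_nz [OF w] by (auto intro!: derivative_eq_intros simp: field_simps)
    from field_vector_diff_chain_within [OF u' this]
    show "(\<rho>' w has_vector_derivative \<rho>'' w t) (at t within {0..1})"
      by (simp add: o_def \<rho>'_def [abs_def] \<rho>''_def mult.assoc)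
    show "\<rho>' w t \<noteq> 0" using nz [OF w t] w1 [OF w] k_nz [OF w] by (simp add: \<rho>'_def)
  next
    fix w t assume w: "w \<in> K" and t: "0 \<le> t" "t < (1::real)"
    show "cmod (\<rho> w t) < 1"
      using norm_kernel_from_1 [OF w1 [OF w] re [OF w] t] k_nz [OF w]
      by (simp add: \<rho>_def u_def norm_divide)
  next
    fix w assume w: "w \<in> K"
    show "\<rho> w 0 = 0" "\<rho> w 1 = 1" using k_nz [OF w] by (simp_all add: \<rho>_def u_def)
  qed (unfold \<rho>_def \<rho>'_def \<rho>''_def u_def, (intro continuous_intros; use k_nz in force)+)
  moreover have "continuous_on K (\<lambda>w. 1 / \<rho>' w 1)"
    unfolding \<rho>'_def u_def using nz [of _ 1] w1 k_nz by (intro continuous_intros) (auto simp: u_def)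
  moreover have "1 / \<rho>' w 1 \<noteq> 0" if "w \<in> K" for w
    using nz [OF that, of 1] w1 [OF that] k_nz [OF that] by (simp add: \<rho>'_def)
  ultimately obtain m1 where m1: "m1 > 0"
    "\<forall>\<^sub>F n in sequentially. \<forall>w\<in>K. m1 \<le> cmod (of_nat (n + 1) * integral {0..1} (\<lambda>t. \<rho> w t ^ n))"
    by (rule uniform_limit_lower_bound [OF _ K])
  obtain m2 where m2: "m2 > 0" "\<And>w. w \<in> K \<Longrightarrow> m2 \<le> cmod (w - 1)"
    by (rule compact_norm_lower_bound [OF K, of "\<lambda>w. w - 1"]) (use w1 in \<open>auto intro!: continuous_intros\<close>)
  have "\<forall>\<^sub>F n in sequentially. \<forall>w\<in>K.
    (m1 * m2) * cmod (kernel 1 w) ^ n \<le> real (n + 1) * cmod (kernel_prim n 1 w - kernel_prim n 1 1)"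
    using m1(2)
  proof (eventually_elim, intro ballI)
    fix n w
    assume H: "\<forall>w\<in>K. m1 \<le> cmod (of_nat (n + 1) * integral {0..1} (\<lambda>t. \<rho> w t ^ n))" and w: "w \<in> K"
    define I where "I = integral {0..1} (\<lambda>t. \<rho> w t ^ n)"
    define D where "D = kernel_prim n 1 w - kernel_prim n 1 1"
    have "((\<lambda>t. (w - 1) * kernel 1 (u w t) ^ n / ((w - 1) * kernel 1 w ^ n)) has_integral
        D / ((w - 1) * kernel 1 w ^ n)) {0..1}"
      unfolding u_def D_def by (intro has_integral_divide kernel_prim_segment)
    then have "((\<lambda>t. \<rho> w t ^ n) has_integral D / ((w - 1) * kernel 1 w ^ n)) {0..1}"
      using w1 [OF w] by (simp add: \<rho>_def power_divide)
    then have "I = D / ((w - 1) * kernel 1 w ^ n)"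
      unfolding I_def by (rule integral_unique)
    then have D: "D = (w - 1) * kernel 1 w ^ n * I"
      using w1 [OF w] k_nz [OF w] by simp
    have "m1 * m2 \<le> (real (n + 1) * cmod I) * cmod (w - 1)"
      using H w m1(1) m2 by (intro mult_mono) (auto simp only: I_def norm_mult norm_of_nat intro: order_less_imp_le)
    then have "m1 * m2 * cmod (kernel 1 w) ^ n \<le> (real (n + 1) * cmod I) * cmod (w - 1) * cmod (kernel 1 w) ^ n"
      by (rule mult_right_mono) simp
    then show "m1 * m2 * cmod (kernel 1 w) ^ n \<le> real (n + 1) * cmod D"
      unfolding D norm_mult norm_power by (simp only: mult_ac)
  qed
  with that [of "m1 * m2"] m1(1) m2(1) show ?thesis by simp
qed

section \<open>The node of the lemniscate\<close>

text \<open>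
  On the line \<open>Re z = 1/3\<close> the only point of the level set is the node \<open>1/3\<close>, which is not in \<open>L\<close> but is
  a limit of points of \<open>L\<close>: join \<open>1/3 + \<eta>\<close>, where the level function is too small, to \<open>1/3 + i \<eta>\<close>,
  where it is too large, and use the intermediate value theorem.
\<close>
lemma infdist_lemniscate_eq_0:
  assumes z: "cmod (z * (1 - z)\<^sup>2) = 4 / 27" "Re z \<ge> 1 / 3"
  shows "infdist z L = 0"
proof (cases "Re z = 1 / 3")
  case False
  then have "z \<in> L" using z by (simp add: L_def)
  then show ?thesis by simp
next
  case True
  have level_sq: "(cmod (v * (1 - v)\<^sup>2))\<^sup>2
      = ((Re v)\<^sup>2 + (Im v)\<^sup>2) * ((1 - Re v)\<^sup>2 + (Im v)\<^sup>2)\<^sup>2" for v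
  proof -
    have "(cmod (v * (1 - v)\<^sup>2))\<^sup>2 = (cmod v)\<^sup>2 * ((cmod (1 - v))\<^sup>2)\<^sup>2"
      by (simp only: norm_mult norm_power power_mult_distrib)
    then show ?thesis by (simp add: cmod_power2)
  qed
  have on_line: "4 / 27 < cmod (v * (1 - v)\<^sup>2)" if v: "Re v = 1 / 3" "Im v \<noteq> 0" for v
  proof -
    have "(4 / 27)\<^sup>2 = (1 / 9) * (4 / 9 :: real)\<^sup>2" by (simp add: power2_eq_square)
    also have "\<dots> < (1 / 9 + (Im v)\<^sup>2) * (4 / 9 + (Im v)\<^sup>2)\<^sup>2"
      using v by (intro mult_strict_mono power_strict_mono) (auto simp: add_pos_nonneg)
    also have "\<dots> = (cmod (v * (1 - v)\<^sup>2))\<^sup>2"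
      unfolding level_sq v by (simp add: power2_eq_square)
    finally show ?thesis by (rule power2_less_imp_less) simp
  qed
  have "Im z = 0" using on_line [OF True] z by force
  then have z_eq: "z = 1 / 3" using True by (simp add: complex_eq_iff)
  have "z \<in> closure L"
    unfolding closure_approachable
  proof (intro allI impI)
    fix e :: real assume e: "e > 0"
    define \<eta> where "\<eta> = min (1 / 2) (e / 2)"
    have \<eta>: "0 < \<eta>" "\<eta> \<le> 1 / 2" "\<eta> < e" using e by (auto simp: \<eta>_def)
    define v where "v s = Complex (1 / 3 + \<eta> * (1 - s)) (\<eta> * s)" for s
    define g where "g s = cmod (v s * (1 - v s)\<^sup>2)" for s
    have v_alt: "v s = 1 / 3 + of_real (\<eta> * (1 - s)) + \<i> * of_real (\<eta> * s)" for s
      by (simp add: v_def complex_eq_iff)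
    have "continuous_on {0..1} g"
      unfolding g_def v_alt by (intro continuous_intros)
    moreover have "g 0 \<le> 4 / 27"
    proof -
      have "v 0 * (1 - v 0)\<^sup>2 = of_real ((1 / 3 + \<eta>) * (2 / 3 - \<eta>)\<^sup>2)"
        by (simp add: v_alt power2_eq_square algebra_simps)
      then have "g 0 = \<bar>(1 / 3 + \<eta>) * (2 / 3 - \<eta>)\<^sup>2\<bar>"
        unfolding g_def by (simp only: norm_of_real)
      also have "\<dots> = (1 / 3 + \<eta>) * (2 / 3 - \<eta>)\<^sup>2" using \<eta> by simp
      also have "\<dots> = 4 / 27 - \<eta>\<^sup>2 * (1 - \<eta>)" by (simp add: power2_eq_square field_simps)
      also have "\<dots> \<le> 4 / 27" using \<eta> by simp
      finally show ?thesis .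
    qed
    moreover have g1: "4 / 27 < g 1"
      unfolding g_def using \<eta> by (intro on_line) (auto simp: v_def)
    ultimately obtain s where s: "0 \<le> s" "s \<le> 1" "g s = 4 / 27"
      using IVT' [of g 0 "4 / 27" 1] by auto
    with g1 have "s < 1" by (cases "s = 1") auto
    then have "v s \<in> L" using s \<eta> by (simp add: L_def g_def) (simp add: v_def)
    moreover have "dist (v s) z < e"
    proof -
      have "v s - z = of_real (\<eta> * (1 - s)) + \<i> * of_real (\<eta> * s)" by (simp add: v_alt z_eq)
      then have "cmod (v s - z) \<le> cmod (of_real (\<eta> * (1 - s))) + cmod (\<i> * of_real (\<eta> * s))"
        by (simp only: norm_triangle_ineq)
      also have "\<dots> = \<eta> * (1 - s) + \<eta> * s" unfolding norm_mult norm_of_real using s \<eta> by simp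
      also have "\<dots> = \<eta>" by (simp add: algebra_simps)
      finally show ?thesis using \<eta> by (simp add: dist_norm)
    qed
    ultimately show "\<exists>y\<in>L. dist y z < e" by blast
  qed
  then show ?thesis using in_closure_iff_infdist_zero [OF L_nonempty] by blast
qed

section \<open>Boundedness of the zeros\<close>

lemma has_integral_power_0_1: "((\<lambda>t. t ^ m) has_integral 1 / real (m + 1)) {0..1::real}"
proof -
  have "((\<lambda>t. t ^ m) has_integral 1 ^ (m + 1) / real (m + 1) - 0 ^ (m + 1) / real (m + 1)) {0..1::real}"
  proof (rule fundamental_theorem_of_calculus)
    fix t :: real
    show "((\<lambda>t. t ^ (m + 1) / real (m + 1)) has_vector_derivative t ^ m) (at t within {0..1})"
      unfolding has_real_derivative_iff_has_vector_derivative [symmetric]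
      using DERIV_cdivide [OF DERIV_power [OF DERIV_ident, of "m + 1" t "{0..1}"], of "real (m + 1)"]
      by (simp del: of_nat_add of_nat_Suc)
  qed simp
  then show ?thesis by simp
qed

text \<open>
  For large \<open>z\<close> the normalised integrand \<open>t (1 - z t\<^sup>2) / (1 - z)\<close> is a perturbation of \<open>t\<^sup>3\<close>: it equals
  \<open>t \<sigma>(t)\<close> with \<open>\<sigma>(t) = t\<^sup>2 + \<delta> (1 - t\<^sup>2)\<close> and \<open>\<delta> = 1 / (1 - z)\<close>. As \<open>t\<^sup>2\<close> and \<open>\<sigma>\<close> both have modulus
  at most \<open>1\<close>, their \<open>n\<close>-th powers differ by at most \<open>n \<bar>\<delta>\<bar> (1 - t\<^sup>2)\<close>. Integrating against \<open>t\<^sup>n\<close>, the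
  error is at most \<open>2 n \<bar>\<delta>\<bar> / ((n + 1) (n + 3))\<close>, which for \<open>\<bar>\<delta>\<bar> \<le> 1/6\<close> is less than
  \<open>\<integral> t\<^sup>3\<^sup>n = 1 / (3 n + 1)\<close>, for every \<open>n\<close>.
\<close>
lemma F_nonzero_far_from_1:
  assumes z: "cmod (1 - z) \<ge> 6"
  shows "F n z \<noteq> 0"
proof
  assume F0: "F n z = 0"
  define \<delta> where "\<delta> = 1 / (1 - z)"
  have z1: "z \<noteq> 1" using z by auto
  have \<delta>: "cmod \<delta> \<le> 1 / 6" using z by (simp add: \<delta>_def norm_divide divide_simps)
  define \<sigma> where "\<sigma> t = (of_real t)\<^sup>2 + \<delta> * (1 - (of_real t)\<^sup>2)" for t :: real
  have kernel_eq: "kernel z (of_real t) / (1 - z) = of_real t * \<sigma> t" for t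
    using z1 by (simp add: kernel_def \<sigma>_def \<delta>_def divide_simps) (simp add: algebra_simps)
  have "((\<lambda>t. kernel z (of_real t) ^ n / (1 - z) ^ n) has_integral
      F n z / of_nat (n + 1) / (1 - z) ^ n) {0..1}"
    by (intro has_integral_divide F_has_integral)
  then have \<sigma>_int: "((\<lambda>t. (of_real t * \<sigma> t) ^ n) has_integral 0) {0..1}"
    by (simp add: F0 flip: power_divide kernel_eq)
  have "((\<lambda>t. complex_of_real (t ^ (3 * n))) has_integral of_real (1 / real (3 * n + 1))) {0..1}"
    using has_integral_linear [OF has_integral_power_0_1 [of "3 * n"] bounded_linear_of_real]
    by (simp only: o_def)
  from has_integral_diff [OF this \<sigma>_int]
  have diff_int: "((\<lambda>t. of_real (t ^ (3 * n)) - (of_real t * \<sigma> t) ^ n) has_integral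
      of_real (1 / real (3 * n + 1))) {0..1}" by simp
  have bound_int: "((\<lambda>t. real n / 6 * (t ^ n - t ^ (n + 2))) has_integral
      real n / 6 * (1 / real (n + 1) - 1 / real (n + 2 + 1))) {0..1}"
    by (intro has_integral_mult_right has_integral_diff has_integral_power_0_1)
  have "cmod (of_real (t ^ (3 * n)) - (of_real t * \<sigma> t) ^ n) \<le> real n / 6 * (t ^ n - t ^ (n + 2))"
    if t: "t \<in> {0..1}" for t
  proof -
    have t2: "0 \<le> t\<^sup>2" "t\<^sup>2 \<le> 1" using t by (auto simp: power_le_one)
    have norm_t: "cmod ((of_real t)\<^sup>2) = t\<^sup>2" by (simp add: norm_power)
    have "1 - (complex_of_real t)\<^sup>2 = of_real (1 - t\<^sup>2)" by simp
    then have norm_c: "cmod (1 - (of_real t)\<^sup>2) = 1 - t\<^sup>2"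
      using t2 by (simp only: norm_of_real abs_of_nonneg diff_ge_0_iff_ge)
    have err: "cmod (\<delta> * (1 - (of_real t)\<^sup>2)) \<le> 1 / 6 * (1 - t\<^sup>2)"
      unfolding norm_mult norm_c using \<delta> t2 by (intro mult_right_mono) auto
    have "cmod (\<sigma> t) \<le> t\<^sup>2 + 1 / 6 * (1 - t\<^sup>2)"
      unfolding \<sigma>_def by (rule norm_triangle_le) (use err norm_t in linarith)
    also have "\<dots> \<le> 1" using t2 by (simp add: field_simps)
    finally have "cmod (((of_real t)\<^sup>2) ^ n - \<sigma> t ^ n) \<le> real n * cmod ((of_real t)\<^sup>2 - \<sigma> t)"
      using t2 by (intro norm_power_diff) (simp_all add: norm_t)
    also have "cmod ((of_real t)\<^sup>2 - \<sigma> t) \<le> 1 / 6 * (1 - t\<^sup>2)"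
      using err by (simp add: \<sigma>_def)
    finally have *: "cmod (((of_real t)\<^sup>2) ^ n - \<sigma> t ^ n) \<le> real n * (1 / 6 * (1 - t\<^sup>2))"
      by (simp add: mult_left_mono)
    have "of_real (t ^ (3 * n)) - (of_real t * \<sigma> t) ^ n
        = of_real (t ^ n) * (((of_real t)\<^sup>2) ^ n - \<sigma> t ^ n)"
      by (simp add: power_mult_distrib algebra_simps flip: power_mult power_add)
    then have "cmod (of_real (t ^ (3 * n)) - (of_real t * \<sigma> t) ^ n)
        = t ^ n * cmod (((of_real t)\<^sup>2) ^ n - \<sigma> t ^ n)"
      using t by (simp add: norm_mult norm_power)
    also have "\<dots> \<le> t ^ n * (real n * (1 / 6 * (1 - t\<^sup>2)))"
      using * t by (intro mult_left_mono) auto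
    also have "\<dots> = real n / 6 * (t ^ n - t ^ (n + 2))"
      by (simp add: power_add field_simps power2_eq_square)
    finally show ?thesis .
  qed
  then have "cmod (integral {0..1} (\<lambda>t. of_real (t ^ (3 * n)) - (of_real t * \<sigma> t) ^ n))
      \<le> integral {0..1} (\<lambda>t. real n / 6 * (t ^ n - t ^ (n + 2)))"
    using diff_int bound_int by (intro integral_norm_bound_integral) (blast intro: has_integral_integrable)+
  then have "cmod (of_real (1 / real (3 * n + 1))) \<le> real n / 6 * (1 / real (n + 1) - 1 / real (n + 2 + 1))"
    by (simp only: integral_unique [OF diff_int] integral_unique [OF bound_int])
  then have "1 / (3 * real n + 1) \<le> real n / 6 * (1 / (real n + 1) - 1 / (real n + 3))"
    unfolding norm_of_real by (simp add: add.commute)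
  moreover have "real n / 6 * (1 / (x + 1) - 1 / (x + 3)) < 1 / (3 * x + 1)" if "x = real n" for x
    using that by (simp add: divide_simps) (simp add: algebra_simps)
  ultimately show False by fastforce
qed

section \<open>The saddle point contribution\<close>

lemma critical_value_square: "(2 / (3 * sqrt 3))\<^sup>2 = (4 / 27 :: real)"
  by (simp add: power_divide power_mult_distrib)

lemma kernel_of_real: "kernel 1 (of_real t) = of_real (t * (1 - t\<^sup>2))"
  by (simp add: kernel_def)

text \<open>
  After squaring, the difference of the two sides is a polynomial in \<open>t\<^sup>2\<close> with a double root at the
  critical point \<open>t\<^sup>2 = 1/3\<close> and the remaining root \<open>4/3\<close>.
\<close>
lemma kernel_le_critical_value:
  assumes "t \<in> {0..1}"
  shows "t * (1 - t\<^sup>2) \<le> 2 / (3 * sqrt 3)"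
proof (rule power2_le_imp_le)
  have "4 / 27 - (t * (1 - t\<^sup>2))\<^sup>2 = (t\<^sup>2 - 1 / 3)\<^sup>2 * (4 / 3 - t\<^sup>2)"
    by (simp add: power2_eq_square algebra_simps)
  also have "\<dots> \<ge> 0" using assms power_le_one [of t 2] by simp
  finally show "(t * (1 - t\<^sup>2))\<^sup>2 \<le> (2 / (3 * sqrt 3))\<^sup>2" unfolding critical_value_square by simp
qed simp

lemma kernel_prim_1_has_integral:
  "((\<lambda>t. of_real ((t * (1 - t\<^sup>2)) ^ n)) has_integral kernel_prim n 1 1) {0..1}"
  using kernel_prim_segment [of 1 0 1 n] by (simp add: kernel_of_real)

lemma kernel_prim_1_upper: "cmod (kernel_prim n 1 1) \<le> (2 / (3 * sqrt 3)) ^ n"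
proof -
  have "cmod (kernel_prim n 1 1) \<le> (2 / (3 * sqrt 3)) ^ n * measure lborel {0..1::real}"
  proof (intro has_integral_bound_real [where S = "{}", OF _ finite.emptyI kernel_prim_1_has_integral])
    fix t :: real assume "t \<in> {0..1} - {}"
    then have t: "t \<in> {0..1}" by simp
    have "0 \<le> t * (1 - t\<^sup>2)" using t by (simp add: power_le_one)
    then show "cmod (of_real ((t * (1 - t\<^sup>2)) ^ n)) \<le> (2 / (3 * sqrt 3)) ^ n"
      unfolding norm_of_real using kernel_le_critical_value [OF t] by (simp add: power_mono)
  qed simp
  then show ?thesis by simp
qed

text \<open>
  The exponential growth rate comes from an interval next to the maximum \<open>t = 1 / \<surd>3\<close> of \<open>t (1 - t\<^sup>2)\<close>, on
  which this function exceeds \<open>c\<close>. The constant \<open>m\<close> is the length of this interval.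
\<close>
lemma kernel_prim_1_lower:
  assumes "0 \<le> c" "c < 2 / (3 * sqrt 3)"
  obtains m where "m > 0" "\<And>n. m * c ^ n \<le> cmod (kernel_prim n 1 1)"
proof -
  define t0 where "t0 = 1 / sqrt (3::real)"
  have t0: "0 < t0" "t0 < 1" by (simp_all add: t0_def)
  have "t0 * (1 - t0\<^sup>2) = 2 / (3 * sqrt 3)" by (simp add: t0_def power_divide)
  then have "c < t0 * (1 - t0\<^sup>2)" using assms by simp
  moreover have "((\<lambda>t. t * (1 - t\<^sup>2)) \<longlongrightarrow> t0 * (1 - t0\<^sup>2)) (at t0)" by (intro tendsto_intros)
  ultimately have "\<forall>\<^sub>F t in at t0. c < t * (1 - t\<^sup>2)" by (rule order_tendstoD(1) [rotated])
  then obtain d where d: "d > 0" "\<And>t. t \<noteq> t0 \<Longrightarrow> dist t t0 < d \<Longrightarrow> c < t * (1 - t\<^sup>2)"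
    unfolding eventually_at by blast
  define h where "h = min (d / 2) t0"
  have h: "0 < h" "h \<le> t0" "h < d" using d t0 by (auto simp: h_def)
  have near: "c \<le> t * (1 - t\<^sup>2)" if "t \<in> {t0 - h..t0}" for t
    using d(2) [of t] \<open>c < t0 * (1 - t0\<^sup>2)\<close> that h by (cases "t = t0") (auto simp: dist_real_def)
  have "h * c ^ n \<le> cmod (kernel_prim n 1 1)" for n
  proof -
    define f where "f t = (t * (1 - t\<^sup>2)) ^ n" for t :: real
    have int: "f integrable_on {a..b}" for a b
      unfolding f_def by (intro integrable_continuous_real continuous_intros)
    have "((\<lambda>t. Re (of_real (f t))) has_integral Re (kernel_prim n 1 1)) {0..1}"
      using has_integral_linear [OF kernel_prim_1_has_integral bounded_linear_Re]
      by (simp only: o_def f_def)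
    then have f_int: "integral {0..1} f = Re (kernel_prim n 1 1)" by (simp add: integral_unique)
    have "h * c ^ n = integral {t0 - h..t0} (\<lambda>t. c ^ n)" using h by simp
    also have "\<dots> \<le> integral {t0 - h..t0} f"
      using near assms by (intro integral_le int integrable_const_ivl) (simp add: f_def power_mono)
    also have "\<dots> \<le> integral {0..1} f"
      using h t0 by (intro integral_subset_le int) (auto simp: f_def power_le_one)
    also have "\<dots> \<le> cmod (kernel_prim n 1 1)" unfolding f_int by (rule complex_Re_le_cmod)
    finally show ?thesis .
  qed
  with h(1) that show ?thesis by blast
qed

section \<open>Zeros off the lemniscate\<close>

lemma eventually_const_mult_power_less:
  fixes B m x y :: real
  assumes "0 \<le> x" "x < y" "0 < m"
  shows "\<forall>\<^sub>F n in sequentially. real (n + 1) * (B * x ^ n) < m * y ^ n"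
proof -
  have y: "0 < y" and xy: "norm (x / y) < 1" using assms by auto
  have "(\<lambda>n. B * (real n * (x / y) ^ n + (x / y) ^ n)) \<longlonglongrightarrow> B * (0 + 0)"
    by (intro tendsto_mult tendsto_add tendsto_const powser_times_n_limit_0 LIMSEQ_power_zero xy)
  then have "\<forall>\<^sub>F n in sequentially. B * (real n * (x / y) ^ n + (x / y) ^ n) < m"
    by (rule order_tendstoD(2)) (use assms(3) in simp)
  then show ?thesis
  proof eventually_elim
    fix n assume "B * (real n * (x / y) ^ n + (x / y) ^ n) < m"
    then have "B * (real n * (x / y) ^ n + (x / y) ^ n) * y ^ n < m * y ^ n"
      using y by (intro mult_strict_right_mono) auto
    moreover have "B * (real n * (x / y) ^ n + (x / y) ^ n) * y ^ n = real (n + 1) * (B * x ^ n)"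
      using y by (simp add: power_divide field_simps)
    ultimately show "real (n + 1) * (B * x ^ n) < m * y ^ n" by simp
  qed
qed

text \<open>
  By compactness \<open>\<bar>P\<bar>\<close> stays at distance \<open>\<delta>\<close> from the critical value. Where it is larger, the path from
  \<open>1\<close> to \<open>w\<close> outweighs the integral over \<open>[0, 1]\<close>; where it is smaller, the integral over \<open>[0, 1]\<close>
  outweighs the path.
\<close>
lemma kernel_prim_nonzero_right_of_one_third:
  assumes K: "compact K" and re: "\<And>w. w \<in> K \<Longrightarrow> 1 / sqrt 3 \<le> Re w"
    and level: "\<And>w. w \<in> K \<Longrightarrow> cmod (kernel 1 w) \<noteq> 2 / (3 * sqrt 3)"
  shows "\<forall>\<^sub>F n in sequentially. \<forall>w\<in>K. kernel_prim n 1 w \<noteq> 0"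
proof -
  define c :: real where "c = 2 / (3 * sqrt 3)"
  have c: "0 < c" by (simp add: c_def)
  have cont: "continuous_on K (\<lambda>w. cmod (kernel 1 w))" by (intro continuous_intros)
  obtain \<delta>0 where \<delta>0: "\<delta>0 > 0" "\<And>w. w \<in> K \<Longrightarrow> \<delta>0 \<le> norm (cmod (kernel 1 w) - c)"
    by (rule compact_norm_lower_bound [OF K, of "\<lambda>w. cmod (kernel 1 w) - c"])
      (use level cont in \<open>auto intro!: continuous_intros simp: c_def\<close>)
  \<comment> \<open>The minimum keeps \<open>c - \<delta>\<close> positive, as a base of powers must be.\<close>
  define \<delta> where "\<delta> = min \<delta>0 (c / 2)"
  have \<delta>: "0 < \<delta>" "\<delta> < c" using \<delta>0 c by (auto simp: \<delta>_def)
  define K_out where "K_out = {w \<in> K. c + \<delta> \<le> cmod (kernel 1 w)}"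
  define K_in where "K_in = {w \<in> K. cmod (kernel 1 w) \<le> c - \<delta>}"
  have split: "w \<in> K_out \<or> w \<in> K_in" if "w \<in> K" for w
    using \<delta>0(2) [OF that] that by (auto simp: K_out_def K_in_def \<delta>_def abs_if split: if_splits)

  have "\<forall>\<^sub>F n in sequentially. \<forall>w\<in>K_out. kernel_prim n 1 w \<noteq> 0"
  proof -
    have "compact K_out"
    proof -
      have "K_out = K \<inter> {w. c + \<delta> \<le> cmod (kernel 1 w)}" by (auto simp: K_out_def)
      then show ?thesis
        by (simp only:) (intro compact_Int_closed K closed_Collect_le continuous_intros)
    qed
    moreover have "of_real (1 / sqrt 3) \<notin> K_out"
    proof
      assume "of_real (1 / sqrt 3) \<in> K_out"
      then have "cmod (kernel 1 (of_real (1 / sqrt 3))) \<noteq> 2 / (3 * sqrt 3)"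
        using level by (auto simp: K_out_def)
      then show False unfolding kernel_of_real norm_of_real by (simp add: power_divide)
    qed
    moreover have "1 \<notin> K_out" using c \<delta> by (simp add: K_out_def)
    ultimately obtain m where m: "m > 0" "\<forall>\<^sub>F n in sequentially. \<forall>w\<in>K_out.
        m * cmod (kernel 1 w) ^ n \<le> real (n + 1) * cmod (kernel_prim n 1 w - kernel_prim n 1 1)"
      using re by (auto simp: K_out_def intro: kernel_prim_dominates_right_of_one_third [of K_out])
    have "\<forall>\<^sub>F n in sequentially. real (n + 1) * (1 * c ^ n) < m * (c + \<delta>) ^ n"
      using m(1) c \<delta> by (intro eventually_const_mult_power_less) auto
    with m(2) show ?thesis
    proof (eventually_elim, intro ballI notI)
      fix n w
      assume H: "\<forall>w\<in>K_out. m * cmod (kernel 1 w) ^ n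
            \<le> real (n + 1) * cmod (kernel_prim n 1 w - kernel_prim n 1 1)"
        and less: "real (n + 1) * (1 * c ^ n) < m * (c + \<delta>) ^ n"
        and w: "w \<in> K_out" and 0: "kernel_prim n 1 w = 0"
      have "m * (c + \<delta>) ^ n \<le> m * cmod (kernel 1 w) ^ n"
        using w m(1) c \<delta> by (intro mult_left_mono power_mono) (auto simp: K_out_def)
      also have "\<dots> \<le> real (n + 1) * cmod (kernel_prim n 1 w - kernel_prim n 1 1)"
        using H w by blast
      also have "\<dots> = real (n + 1) * cmod (kernel_prim n 1 1)" by (simp add: 0)
      also have "\<dots> \<le> real (n + 1) * c ^ n"
        using kernel_prim_1_upper [of n] by (intro mult_left_mono) (auto simp: c_def)
      finally show False using less by simp
    qed
  qed
  moreover have "\<forall>\<^sub>F n in sequentially. \<forall>w\<in>K_in. kernel_prim n 1 w \<noteq> 0"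
  proof -
    obtain m where m: "m > 0" "\<And>n. m * (c - \<delta> / 2) ^ n \<le> cmod (kernel_prim n 1 1)"
      using kernel_prim_1_lower [of "c - \<delta> / 2"] c \<delta> by (auto simp: c_def)
    obtain B where B: "B > 0" "\<And>w. w \<in> K \<Longrightarrow> cmod w \<le> B"
      using compact_imp_bounded [OF K] by (auto simp: bounded_pos)
    have "\<forall>\<^sub>F n in sequentially. real (n + 1) * ((B + 1) * (c - \<delta>) ^ n) < m * (c - \<delta> / 2) ^ n"
      using m(1) c \<delta> by (intro eventually_const_mult_power_less) auto
    then show ?thesis
    proof (eventually_elim, intro ballI notI)
      fix n w
      assume less: "real (n + 1) * ((B + 1) * (c - \<delta>) ^ n) < m * (c - \<delta> / 2) ^ n"
        and w: "w \<in> K_in" and 0: "kernel_prim n 1 w = 0"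
      have wK: "w \<in> K" and w_le: "cmod (kernel 1 w) \<le> c - \<delta>" using w by (auto simp: K_in_def)
      have "cmod (kernel_prim n 1 w - kernel_prim n 1 1)
          \<le> ((B + 1) * (c - \<delta>) ^ n) * measure lborel {0..1::real}"
      proof (rule has_integral_bound_real [where S = "{}", OF _ finite.emptyI kernel_prim_segment])
        fix t :: real assume t: "t \<in> {0..1} - {}"
        have "cmod (kernel 1 (1 + of_real t * (w - 1))) \<le> cmod (kernel 1 w)"
          using norm_kernel_from_1 [OF _ re [OF wK], of t] t
          by (cases "w = 1"; cases "t = 1") auto
        then have "cmod (kernel 1 (1 + of_real t * (w - 1))) \<le> c - \<delta>" using w_le by simp
        moreover have "cmod (w - 1) \<le> B + 1"
          using norm_triangle_ineq4 [of w 1] B(2) [OF wK] by simp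
        ultimately show "cmod ((w - 1) * kernel 1 (1 + of_real t * (w - 1)) ^ n) \<le> (B + 1) * (c - \<delta>) ^ n"
          unfolding norm_mult norm_power using B(1) by (intro mult_mono power_mono) auto
      qed (use B \<delta> in auto)
      then have "cmod (kernel_prim n 1 1) \<le> (B + 1) * (c - \<delta>) ^ n" by (simp add: 0)
      also have "\<dots> \<le> real (n + 1) * ((B + 1) * (c - \<delta>) ^ n)"
        using B \<delta> mult_right_mono [of 1 "real (n + 1)" "(B + 1) * (c - \<delta>) ^ n"] by simp
      finally show False using less m(2) [of n] by linarith
    qed
  qed
  ultimately show ?thesis
    by eventually_elim (use split in blast)
qed

theorem theorem1:
  fixes \<epsilon> :: real
  assumes "\<epsilon> > 0"
  shows "\<exists>N::nat. \<forall>n\<ge>N. n \<ge> 1 \<longrightarrow> (\<forall>\<zeta>::complex. F n \<zeta> = 0 \<longrightarrow> infdist \<zeta> L < \<epsilon>)"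
proof -
  \<comment> \<open>To the left of the critical line the estimates are in terms of \<open>z\<close>, to the right in terms of
    the square root \<open>w\<close> of \<open>z\<close> with nonnegative real part.\<close>
  define K1 where "K1 = {z. cmod (1 - z) \<le> 6 \<and> Re z \<le> 1 / 3 \<and> \<epsilon> \<le> infdist z L}"
  define K2 where "K2 = {w. cmod (1 - w\<^sup>2) \<le> 6 \<and> 1 / sqrt 3 \<le> Re w \<and> 1 / 3 \<le> Re (w\<^sup>2) \<and> \<epsilon> \<le> infdist (w\<^sup>2) L}"
  have "compact K1"
    unfolding compact_eq_bounded_closed
  proof
    show "bounded K1"
      by (rule bounded_subset [OF bounded_cball [of 1 6]]) (auto simp: K1_def dist_norm)
    show "closed K1"
      unfolding K1_def by (intro closed_Collect_conj closed_Collect_le continuous_intros)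
  qed
  moreover have "1 / 3 \<notin> K1"
  proof -
    have "infdist (1 / 3 :: complex) L = 0"
      by (rule infdist_lemniscate_eq_0) (simp_all add: norm_mult norm_power power2_eq_square)
    then show ?thesis using assms by (simp add: K1_def)
  qed
  ultimately have ev1: "\<forall>\<^sub>F n in sequentially. \<forall>z\<in>K1. F n z \<noteq> 0"
    by (intro F_nonzero_left_of_one_third) (auto simp: K1_def)
  have "compact K2"
    unfolding compact_eq_bounded_closed
  proof
    have "cmod w \<le> 3" if "w \<in> K2" for w
    proof (rule power2_le_imp_le)
      have "(cmod w)\<^sup>2 = cmod (1 - (1 - w\<^sup>2))" by (simp add: norm_power)
      also have "\<dots> \<le> cmod 1 + cmod (1 - w\<^sup>2)" by (rule norm_triangle_ineq4)
      also have "\<dots> \<le> 3\<^sup>2" using that by (simp add: K2_def)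
      finally show "(cmod w)\<^sup>2 \<le> 3\<^sup>2" .
    qed simp
    then show "bounded K2" by (auto simp: bounded_iff)
    show "closed K2"
      unfolding K2_def by (intro closed_Collect_conj closed_Collect_le continuous_intros)
  qed
  moreover have "cmod (kernel 1 w) \<noteq> 2 / (3 * sqrt 3)" if w: "w \<in> K2" for w
  proof
    assume "cmod (kernel 1 w) = 2 / (3 * sqrt 3)"
    then have "(cmod (kernel 1 w))\<^sup>2 = 4 / 27" by (simp only: critical_value_square)
    then have "cmod (w\<^sup>2 * (1 - w\<^sup>2)\<^sup>2) = 4 / 27"
      by (simp add: kernel_def norm_mult norm_power power_mult_distrib)
    then have "infdist (w\<^sup>2) L = 0" using w by (intro infdist_lemniscate_eq_0) (auto simp: K2_def)
    then show False using w assms by (simp add: K2_def)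
  qed
  ultimately have ev2: "\<forall>\<^sub>F n in sequentially. \<forall>w\<in>K2. kernel_prim n 1 w \<noteq> 0"
    by (intro kernel_prim_nonzero_right_of_one_third) (auto simp: K2_def)
  from ev1 ev2 have "\<forall>\<^sub>F n in sequentially. \<forall>\<zeta>. F n \<zeta> = 0 \<longrightarrow> \<not> \<epsilon> \<le> infdist \<zeta> L"
  proof (eventually_elim, intro allI impI notI)
    fix n \<zeta>
    assume H1: "\<forall>z\<in>K1. F n z \<noteq> 0" and H2: "\<forall>w\<in>K2. kernel_prim n 1 w \<noteq> 0"
      and 0: "F n \<zeta> = 0" and far: "\<epsilon> \<le> infdist \<zeta> L"
    have near: "cmod (1 - \<zeta>) \<le> 6" using F_nonzero_far_from_1 [of \<zeta> n] 0 by force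
    have right: "1 / 3 \<le> Re \<zeta>" using H1 0 far near by (force simp: K1_def)
    define w where "w = csqrt \<zeta>"
    have w2: "w\<^sup>2 = \<zeta>" by (simp add: w_def)
    have "1 / sqrt 3 \<le> Re w"
    proof (rule power2_le_imp_le)
      have "1 / 3 \<le> (Re w)\<^sup>2 - (Im w)\<^sup>2" using right by (simp flip: w2 Re_power2)
      then have "1 / 3 \<le> (Re w)\<^sup>2" using zero_le_power2 [of "Im w"] by linarith
      then show "(1 / sqrt 3)\<^sup>2 \<le> (Re w)\<^sup>2" by (simp add: power_divide)
      show "0 \<le> Re w" using csqrt_principal [of \<zeta>] by (auto simp: w_def)
    qed
    then have "w \<in> K2" using far near right by (simp add: K2_def w2)
    moreover have "kernel_prim n 1 w = 0"
    proof -
      have "kernel_prim n \<zeta> 1 = 0"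
        using 0 of_nat_neq_0 [of n, where 'a = complex] by (simp add: F_eq_kernel_prim)
      then show ?thesis using kernel_prim_scale [of w n] by (simp add: w2)
    qed
    ultimately show False using H2 by blast
  qed
  then show ?thesis unfolding eventually_sequentially not_le by blast
qed

end
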